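(* Let $R$ be a unique factorization domain and $f$ a primitive Dirichlet polynomial with coefficients in $R$, of degree $n\ge2$, with $n$ not square-free. Fix an arbitrary integer $m\ge2$. Then the following are equivalent: (i) $f$ is square-free; (ii) for every prime factor $p$ of $n$ with multiplicity at least $2$ and every Dirichlet polynomial $g$ with coefficients in $R$ of degree at most $n/p$, $g^m$ is not divisible by $f$; (iii) for every prime factor $p$ of $n$ with multiplicity at least $2$ and every Dirichlet polynomial $g$ with coefficients in $R$ of degree exactly $n/p$, $g^m$ is not divisible by $f$.
   Context: Dirichlet polynomials over $R$ (finite sums $\sum_i\frac{a_i}{i^s}$) form a unique factorization domain under termwise addition and the Dirichlet product $\left(\sum_j\frac{b_j}{j^s}\right)\left(\sum_k\frac{c_k}{k^s}\right)=\sum_i\frac{\sum_{jk=i}b_jc_k}{i^s}$; divisibility refers to this ring. The degree is the largest index with nonzero coefficient. $f$ is primitive if its coefficients are coprime in $R$, and square-free if it has no repeated irreducible factors (including irreducible elements of $R$). *)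

theory Defs
  imports
    "HOL-Computational_Algebra.Factorial_Ring"
    "HOL-Computational_Algebra.Primes"
    "HOL-Computational_Algebra.Squarefree"
begin

text \<open>
  The finite sum of the terms \<open>a\<^sub>i / i\<^sup>s\<close>, with \<open>i \<ge> 1\<close>, is represented by its coefficient
  function \<open>i \<mapsto> a\<^sub>i\<close>. Only positive indices are meaningful, so the value at \<open>0\<close> is fixed to be \<open>0\<close>.
\<close>

typedef (overloaded) 'a dirichlet_poly =
  "{a :: nat \<Rightarrow> 'a :: zero. a 0 = 0 \<and> finite {i. a i \<noteq> 0}}"
  morphisms dcoeff Abs_dirichlet_poly
  by (rule exI[of _ "\<lambda>_. 0"]) simp

setup_lifting type_definition_dirichlet_poly

lemma dirichlet_poly_eqI: "(\<And>i. dcoeff f i = dcoeff g i) \<Longrightarrow> f = g"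
  by (simp add: dcoeff_inject[symmetric] fun_eq_iff)

lemma dcoeff_0_right [simp]: "dcoeff f 0 = 0"
  using dcoeff[of f] by simp

lemma finite_dcoeff [simp]: "finite {i. dcoeff f i \<noteq> 0}"
  using dcoeff[of f] by simp

lemma finite_mult_pairs: "i > 0 \<Longrightarrow> finite {(j, k). j * k = (i :: nat)}"
  by (rule finite_subset[of _ "{..i} \<times> {..i}"]) auto

instantiation dirichlet_poly :: (comm_ring_1) comm_ring_1
begin

lift_definition zero_dirichlet_poly :: "'a dirichlet_poly" is "\<lambda>_. 0"
  by simp

lift_definition one_dirichlet_poly :: "'a dirichlet_poly" is "\<lambda>i. if i = 1 then 1 else 0"
  by simp

lift_definition plus_dirichlet_poly ::
    "'a dirichlet_poly \<Rightarrow> 'a dirichlet_poly \<Rightarrow> 'a dirichlet_poly" is "\<lambda>a b i. a i + b i"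
proof -
  fix a b :: "nat \<Rightarrow> 'a"
  assume "a 0 = 0 \<and> finite {i. a i \<noteq> 0}" "b 0 = 0 \<and> finite {i. b i \<noteq> 0}"
  moreover have "{i. a i + b i \<noteq> 0} \<subseteq> {i. a i \<noteq> 0} \<union> {i. b i \<noteq> 0}" by auto
  ultimately show "a 0 + b 0 = 0 \<and> finite {i. a i + b i \<noteq> 0}"
    using finite_subset by fastforce
qed

lift_definition uminus_dirichlet_poly :: "'a dirichlet_poly \<Rightarrow> 'a dirichlet_poly" is "\<lambda>a i. - a i"
  by simp

definition minus_dirichlet_poly ::
    "'a dirichlet_poly \<Rightarrow> 'a dirichlet_poly \<Rightarrow> 'a dirichlet_poly" where
  "minus_dirichlet_poly f g = f + - g"

lift_definition times_dirichlet_poly ::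
    "'a dirichlet_poly \<Rightarrow> 'a dirichlet_poly \<Rightarrow> 'a dirichlet_poly"
  is "\<lambda>b c i. if i = 0 then 0 else \<Sum>(j, k) | j * k = i. b j * c k"
proof -
  fix b c :: "nat \<Rightarrow> 'a"
  assume *: "b 0 = 0 \<and> finite {i. b i \<noteq> 0}" "c 0 = 0 \<and> finite {i. c i \<noteq> 0}"
  have "{i. (if i = 0 then 0 else \<Sum>(j, k) | j * k = i. b j * c k) \<noteq> 0}
        \<subseteq> (\<lambda>(j, k). j * k) ` ({i. b i \<noteq> 0} \<times> {i. c i \<noteq> 0})"
  proof
    fix i assume "i \<in> {i. (if i = 0 then 0 else \<Sum>(j, k) | j * k = i. b j * c k) \<noteq> 0}"
    hence "(\<Sum>(j, k) | j * k = i. b j * c k) \<noteq> 0" by (auto split: if_splits)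
    then obtain x where "x \<in> {(j, k). j * k = i}" "(case x of (j, k) \<Rightarrow> b j * c k) \<noteq> 0"
      by (rule sum.not_neutral_contains_not_neutral)
    then obtain j k where "j * k = i" "b j * c k \<noteq> 0" by auto
    moreover from this have "b j \<noteq> 0" "c k \<noteq> 0" by auto
    ultimately show "i \<in> (\<lambda>(j, k). j * k) ` ({i. b i \<noteq> 0} \<times> {i. c i \<noteq> 0})"
      by (intro image_eqI[of _ _ "(j, k)"]) auto
  qed
  thus "(if (0::nat) = 0 then 0 else \<Sum>(j, k) | j * k = 0. b j * c k) = 0 \<and>
        finite {i. (if i = 0 then 0 else \<Sum>(j, k) | j * k = i. b j * c k) \<noteq> 0}"
    using * by (metis (no_types, lifting) finite_SigmaI finite_imageI finite_subset)
qed

lemma dcoeff_mult: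
  "i > 0 \<Longrightarrow> dcoeff (f * g) i = (\<Sum>(j, k) | j * k = i. dcoeff f j * dcoeff g k)"
  by transfer simp

instance
proof
  fix f g h :: "'a dirichlet_poly"
  show "f * g * h = f * (g * h)"
  proof (rule dirichlet_poly_eqI)
    fix i
    show "dcoeff (f * g * h) i = dcoeff (f * (g * h)) i"
    proof (cases "i = 0")
      case False
      define T where "T = (\<lambda>i::nat. {(j, k). j * k = i})"
      have dm: "dcoeff (u * v) j = (\<Sum>x\<in>T j. dcoeff u (fst x) * dcoeff v (snd x))"
        if "j > 0" for u v :: "'a dirichlet_poly" and j
        using that by (simp add: dcoeff_mult T_def case_prod_unfold)
      have fin: "finite (T j)" if "j > 0" for j
        using finite_mult_pairs[OF that] by (simp add: T_def)
      have pos: "fst x > 0" "snd x > 0" if "x \<in> T i" for x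
        using that False by (auto simp: T_def intro!: Nat.gr0I)
      have "dcoeff (f * g * h) i =
              (\<Sum>x\<in>T i. \<Sum>y\<in>T (fst x). dcoeff f (fst y) * dcoeff g (snd y) * dcoeff h (snd x))"
        using False pos by (simp add: dm sum_distrib_right)
      also have "\<dots> = (\<Sum>(x, y)\<in>(SIGMA x:T i. T (fst x)).
                         dcoeff f (fst y) * dcoeff g (snd y) * dcoeff h (snd x))"
        using fin pos False by (intro sum.Sigma) auto
      also have "\<dots> = (\<Sum>(x, y)\<in>(SIGMA x:T i. T (snd x)).
                         dcoeff f (fst x) * (dcoeff g (fst y) * dcoeff h (snd y)))"
        by (rule sum.reindex_bij_witness[where
              i = "\<lambda>(x, y). ((fst x * fst y, snd y), (fst x, fst y))" and
              j = "\<lambda>(x, y). ((fst y, snd y * snd x), (snd y, snd x))"])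
           (auto simp: T_def algebra_simps)
      also have "\<dots> = (\<Sum>x\<in>T i. \<Sum>y\<in>T (snd x).
                         dcoeff f (fst x) * (dcoeff g (fst y) * dcoeff h (snd y)))"
        using fin pos False by (intro sum.Sigma[symmetric]) auto
      also have "\<dots> = dcoeff (f * (g * h)) i"
        using False pos by (simp add: dm sum_distrib_left)
      finally show ?thesis .
    qed simp
  qed
  show "f * g = g * f"
  proof (rule dirichlet_poly_eqI)
    fix i
    show "dcoeff (f * g) i = dcoeff (g * f) i"
    proof (cases "i = 0")
      case False
      thus ?thesis
        by (simp add: dcoeff_mult, intro sum.reindex_bij_witness[where i = prod.swap and j = prod.swap])
           (auto simp: algebra_simps)
    qed simp
  qed
  show "1 * f = f"
  proof (rule dirichlet_poly_eqI)
    fix i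
    show "dcoeff (1 * f) i = dcoeff f i"
    proof (cases "i = 0")
      case False
      have "dcoeff (1 * f) i = (\<Sum>(j, k) | j * k = i. (if j = 1 then 1 else 0) * dcoeff f k)"
        using False by (simp add: dcoeff_mult one_dirichlet_poly.rep_eq)
      also have "\<dots> = (\<Sum>(j, k)\<in>{(1 :: nat, i)}. (if j = 1 then 1 else 0) * dcoeff f k)"
        using False by (intro sum.mono_neutral_right finite_mult_pairs) (auto split: if_splits)
      finally show ?thesis by simp
    qed simp
  qed
  show "(f + g) * h = f * h + g * h"
  proof (rule dirichlet_poly_eqI)
    fix i
    show "dcoeff ((f + g) * h) i = dcoeff (f * h + g * h) i"
      by (cases "i = 0")
         (simp_all add: dcoeff_mult plus_dirichlet_poly.rep_eq case_prod_unfold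
            sum.distrib[symmetric] algebra_simps)
  qed
  show "(0 :: 'a dirichlet_poly) \<noteq> 1"
    by transfer (auto simp: fun_eq_iff)
  show "f + g + h = f + (g + h)" by transfer (simp add: algebra_simps)
  show "f + g = g + f" by transfer (simp add: algebra_simps)
  show "0 + f = f" by transfer simp
  show "- f + f = 0" by transfer simp
  show "f - g = f + - g" by (simp add: minus_dirichlet_poly_def)
qed

end

text \<open>The zero polynomial has no degree; it gets the value \<open>0\<close>, which is not a valid index.\<close>

definition ddegree :: "'a :: zero dirichlet_poly \<Rightarrow> nat" where
  "ddegree f = (if \<forall>i. dcoeff f i = 0 then 0 else Max {i. dcoeff f i \<noteq> 0})"

definition dprimitive :: "'a :: comm_ring_1 dirichlet_poly \<Rightarrow> bool" where
  "dprimitive f \<longleftrightarrow> (\<forall>d. (\<forall>i. d dvd dcoeff f i) \<longrightarrow> d dvd 1)"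

text \<open>
  Irreducibility is meant in the ring of Dirichlet polynomials, so \<open>q\<close> may be a constant,
  that is, an irreducible element of the coefficient ring.
\<close>

definition dsquare_free :: "'a :: comm_ring_1 dirichlet_poly \<Rightarrow> bool" where
  "dsquare_free f \<longleftrightarrow> \<not> (\<exists>q. irreducible q \<and> q ^ 2 dvd f)"

lemma ddegree_pos: "f \<noteq> 0 \<Longrightarrow> ddegree f > 0"
  and dcoeff_ddegree: "f \<noteq> 0 \<Longrightarrow> dcoeff f (ddegree f) \<noteq> 0"
  and ddegree_ge: "dcoeff f i \<noteq> 0 \<Longrightarrow> i \<le> ddegree f"
  for f :: "'a :: comm_ring_1 dirichlet_poly"
proof -
  show ge: "dcoeff f i \<noteq> 0 \<Longrightarrow> i \<le> ddegree f" for i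
    by (auto simp: ddegree_def)
  assume "f \<noteq> 0"
  then obtain i where i: "dcoeff f i \<noteq> 0"
    using dirichlet_poly_eqI[of f 0] by (auto simp: zero_dirichlet_poly.rep_eq)
  hence "Max {i. dcoeff f i \<noteq> 0} \<in> {i. dcoeff f i \<noteq> 0}"
    by (intro Max_in) auto
  thus "dcoeff f (ddegree f) \<noteq> 0" using i by (auto simp: ddegree_def)
  thus "ddegree f > 0" by (metis dcoeff_0_right gr0I)
qed

instance dirichlet_poly :: (idom) idom
proof
  fix f g :: "'a dirichlet_poly"
  assume nz: "f \<noteq> 0" "g \<noteq> 0"
  define a b where "a = ddegree f" and "b = ddegree g"
  have pos: "a > 0" "b > 0" using nz by (auto simp: a_def b_def ddegree_pos)
  have "dcoeff (f * g) (a * b) = (\<Sum>(j, k) | j * k = a * b. dcoeff f j * dcoeff g k)"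
    using pos by (simp add: dcoeff_mult)
  also have "\<dots> = (\<Sum>(j, k)\<in>{(a, b)}. dcoeff f j * dcoeff g k)"
  proof (intro sum.mono_neutral_right finite_mult_pairs ballI)
    fix x assume x: "x \<in> {(j, k). j * k = a * b} - {(a, b)}"
    obtain j k where [simp]: "x = (j, k)" by (cases x)
    show "(case x of (j, k) \<Rightarrow> dcoeff f j * dcoeff g k) = 0"
    proof (rule ccontr)
      assume "\<not> ?thesis"
      hence "j \<le> a" "k \<le> b" by (auto simp: a_def b_def intro: ddegree_ge)
      moreover have "j * k = a * b" using x by simp
      ultimately have "j = a \<and> k = b"
        using pos by (metis le_neq_implies_less mult_le_mono1 mult_le_mono2 mult_less_mono1 mult_less_mono2 leD not_gr0 mult_is_0 mult.commute mult_cancel1 mult_cancel2)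
      thus False using x by simp
    qed
  qed (use pos in auto)
  also have "\<dots> \<noteq> 0" using nz by (simp add: a_def b_def dcoeff_ddegree)
  finally show "f * g \<noteq> 0" by (auto simp: zero_dirichlet_poly.rep_eq)
qed

end

(*
  If q^2 divides f with q irreducible, then q is not constant because f is primitive. For f = q^2 h
  the element q h, multiplied by a suitable monomial, has degree n/p for a prime p dividing the
  degree of q, and f divides its m-th power.

  Conversely, if f is square-free and divides g^m, then f divides g by unique factorization, so n
  is at most the degree of g. Irreducible elements are prime by an induction adjoining one prime p
  at a time: the Dirichlet polynomials supported on integers with prime factors at most p are the
  ordinary polynomials in x = p^(-s) over those supported on integers with prime factors below p.
*)

theory Submission
  imports Defs "HOL-Computational_Algebra.Polynomial"
begin

section \<open>Multiplication, degrees and units\<close>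

text \<open>The term c / n^s. With n = 1 this embeds the coefficient ring as constants, and with n =
  p, c = 1 it gives the variable x = p^(-s). For n = 0 it is zero, since index 0 must carry no
  coefficient.\<close>

lift_definition dmonom :: "nat \<Rightarrow> 'a :: zero \<Rightarrow> 'a dirichlet_poly"
  is "\<lambda>n c i. if i = n \<and> n > 0 then c else 0"
  by auto

lemma dcoeff_0 [simp]: "dcoeff 0 i = 0"
  by transfer simp

lemma dcoeff_add [simp]: "dcoeff (f + g) i = dcoeff f i + dcoeff g i"
  by transfer simp

lemma dcoeff_uminus [simp]: "dcoeff (- f) i = - dcoeff f i"
  by transfer simp

lemma dcoeff_1: "dcoeff 1 i = (if i = 1 then 1 else 0)"
  by transfer simp

lemma dcoeff_mult_nonzeroE:
  fixes f g :: "'a :: comm_ring_1 dirichlet_poly"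
  assumes "dcoeff (f * g) i \<noteq> 0"
  obtains j k where "i = j * k" "dcoeff f j \<noteq> 0" "dcoeff g k \<noteq> 0"
proof -
  have "i > 0" using assms by (metis dcoeff_0_right gr0I)
  with assms have "(\<Sum>(j, k) | j * k = i. dcoeff f j * dcoeff g k) \<noteq> 0"
    by (simp add: dcoeff_mult)
  then obtain x where "x \<in> {(j, k). j * k = i}" "(case x of (j, k) \<Rightarrow> dcoeff f j * dcoeff g k) \<noteq> 0"
    by (rule sum.not_neutral_contains_not_neutral)
  then obtain j k where "j * k = i" "dcoeff f j * dcoeff g k \<noteq> 0" by auto
  then show ?thesis using that[of j k] by (metis mult_zero_left mult_zero_right)
qed

text \<open>The convolution sum collapses to one term when no other pair of support indices has the
  same product. This rules out cancellation, both for leading terms and for other extremal choices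
  of indices.\<close>

lemma dcoeff_mult_unique:
  fixes f g :: "'a :: comm_ring_1 dirichlet_poly"
  assumes "\<And>i' j'. dcoeff f i' \<noteq> 0 \<Longrightarrow> dcoeff g j' \<noteq> 0 \<Longrightarrow> i' * j' = i * j \<Longrightarrow> i' = i \<and> j' = j"
    and "i > 0" "j > 0"
  shows "dcoeff (f * g) (i * j) = dcoeff f i * dcoeff g j"
proof -
  have "dcoeff (f * g) (i * j) = (\<Sum>(i', j') | i' * j' = i * j. dcoeff f i' * dcoeff g j')"
    using assms by (simp add: dcoeff_mult)
  also have "\<dots> = (\<Sum>(i', j')\<in>{(i, j)}. dcoeff f i' * dcoeff g j')"
  proof (intro sum.mono_neutral_right finite_mult_pairs ballI)
    fix x assume "x \<in> {(i', j'). i' * j' = i * j} - {(i, j)}"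
    then show "(case x of (i', j') \<Rightarrow> dcoeff f i' * dcoeff g j') = 0"
      using assms(1)[of "fst x" "snd x"] by (cases x) force
  qed (use assms in auto)
  finally show ?thesis by simp
qed

lemma dcoeff_dmonom: "dcoeff (dmonom n c) i = (if i = n \<and> n > 0 then c else 0)"
  by transfer simp

lemma dcoeff_dmonom_mult:
  fixes f :: "'a :: comm_ring_1 dirichlet_poly"
  assumes "n > 0"
  shows "dcoeff (dmonom n c * f) i = (if n dvd i then c * dcoeff f (i div n) else 0)"
proof (cases "i > 0 \<and> n dvd i")
  case True
  then obtain j where j: "i = n * j" by auto
  have "dcoeff (dmonom n c * f) (n * j) = dcoeff (dmonom n c) n * dcoeff f j"
    using True assms by (intro dcoeff_mult_unique) (auto simp: j dcoeff_dmonom split: if_splits)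
  then show ?thesis using assms by (simp add: j dcoeff_dmonom)
next
  case False
  have "dcoeff (dmonom n c * f) i = 0" if "\<not> n dvd i"
  proof (rule ccontr)
    assume "\<not> ?thesis"
    then show False
      by (rule dcoeff_mult_nonzeroE) (use that in \<open>auto simp: dcoeff_dmonom split: if_splits\<close>)
  qed
  with False show ?thesis by (cases "i = 0") auto
qed

lemma dmonom_1_mult_dmonom_1:
  "dmonom 1 a * dmonom 1 b = dmonom 1 (a * b :: 'a :: comm_ring_1)"
  by (rule dirichlet_poly_eqI) (simp add: dcoeff_dmonom_mult dcoeff_dmonom)

lemma dmonom_1_1: "dmonom 1 1 = (1 :: 'a :: comm_ring_1 dirichlet_poly)"
  by (rule dirichlet_poly_eqI) (simp add: dcoeff_1 dcoeff_dmonom)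

section \<open>Multiplicativity of the degree\<close>

lemma ddegree_unique:
  fixes f :: "'a :: comm_ring_1 dirichlet_poly"
  assumes "dcoeff f i \<noteq> 0" "\<And>j. dcoeff f j \<noteq> 0 \<Longrightarrow> j \<le> i"
  shows "ddegree f = i"
  using assms ddegree_ge[of f i] dcoeff_ddegree[of f]
  by (metis dcoeff_0 order_antisym)

lemma ddegree_dmonom:
  "n > 0 \<Longrightarrow> c \<noteq> 0 \<Longrightarrow> ddegree (dmonom n (c :: 'a :: comm_ring_1)) = n"
  by (rule ddegree_unique) (auto simp: dcoeff_dmonom split: if_splits)

lemma mult_eq_mult_le_imp_eq:
  fixes a b c d :: nat
  assumes "a \<le> c" "b \<le> d" "a * b = c * d" "c > 0" "d > 0"
  shows "a = c \<and> b = d"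
proof -
  have "\<not> a < c"
  proof
    assume "a < c"
    then have "a * d < c * d" using assms(5) by (rule mult_less_mono1)
    moreover have "a * b \<le> a * d" using assms(2) by (rule mult_le_mono2)
    ultimately show False using assms(3) by linarith
  qed
  with assms(1) have "a = c" by linarith
  moreover from this assms(3,4) have "b = d" by simp
  ultimately show ?thesis by simp
qed

lemma dcoeff_mult_ddegree:
  fixes f g :: "'a :: idom dirichlet_poly"
  assumes nz: "f \<noteq> 0" "g \<noteq> 0"
  shows "dcoeff (f * g) (ddegree f * ddegree g) = dcoeff f (ddegree f) * dcoeff g (ddegree g)"
proof (rule dcoeff_mult_unique)
  fix j k assume "dcoeff f j \<noteq> 0" "dcoeff g k \<noteq> 0" and eq: "j * k = ddegree f * ddegree g"
  then have le: "j \<le> ddegree f" "k \<le> ddegree g" by (auto intro: ddegree_ge)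
  have pos: "ddegree f > 0" "ddegree g > 0" using nz by (auto intro: ddegree_pos)
  then show "j = ddegree f \<and> k = ddegree g"
    using mult_eq_mult_le_imp_eq[OF le eq] by simp
qed (use nz in \<open>auto intro: ddegree_pos\<close>)

lemma ddegree_mult:
  fixes f g :: "'a :: idom dirichlet_poly"
  assumes nz: "f \<noteq> 0" "g \<noteq> 0"
  shows "ddegree (f * g) = ddegree f * ddegree g"
proof (rule ddegree_unique)
  show "dcoeff (f * g) (ddegree f * ddegree g) \<noteq> 0"
    using nz by (simp add: dcoeff_mult_ddegree dcoeff_ddegree)
next
  fix i assume "dcoeff (f * g) i \<noteq> 0"
  then show "i \<le> ddegree f * ddegree g"
    by (rule dcoeff_mult_nonzeroE) (auto intro!: mult_le_mono ddegree_ge)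
qed

lemma ddegree_dvd:
  fixes f g :: "'a :: idom dirichlet_poly"
  assumes "f dvd g" "g \<noteq> 0"
  shows "ddegree f dvd ddegree g"
  using assms by (auto simp: ddegree_mult)

lemma ddegree_eq_1D:
  fixes f :: "'a :: comm_ring_1 dirichlet_poly"
  assumes "ddegree f = 1"
  shows "f = dmonom 1 (dcoeff f 1)"
proof (rule dirichlet_poly_eqI)
  fix i show "dcoeff f i = dcoeff (dmonom 1 (dcoeff f 1)) i"
  proof (cases "i = 1 \<or> i = 0")
    case False
    then have "dcoeff f i = 0" using ddegree_ge[of f i] assms by linarith
    with False show ?thesis by (simp add: dcoeff_dmonom)
  qed (auto simp: dcoeff_dmonom)
qed

section \<open>Divisibility by constants\<close>

lemma dmonom_1_dvd_iff:
  fixes f :: "'a :: comm_ring_1 dirichlet_poly"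
  shows "dmonom 1 c dvd f \<longleftrightarrow> (\<forall>i. c dvd dcoeff f i)"
proof
  assume "dmonom 1 c dvd f"
  then show "\<forall>i. c dvd dcoeff f i" by (auto simp: dcoeff_dmonom_mult elim!: dvdE)
next
  assume *: "\<forall>i. c dvd dcoeff f i"
  \<comment> \<open>The quotient is set to 0 wherever f vanishes, which keeps its support finite:
    for c = 0 any value would satisfy the equation.\<close>
  define b where "b = (\<lambda>i. if dcoeff f i = 0 then 0 else SOME b. dcoeff f i = c * b)"
  have b: "dcoeff f i = c * b i" for i
    using someI_ex[of "\<lambda>b. dcoeff f i = c * b"] * by (auto simp: b_def dvd_def)
  have b_in: "b \<in> {a. a 0 = 0 \<and> finite {i. a i \<noteq> 0}}"
    using finite_subset[OF _ finite_dcoeff[of f], of "{i. b i \<noteq> 0}"] by (auto simp: b_def)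
  have "f = dmonom 1 c * Abs_dirichlet_poly b"
    using b by (intro dirichlet_poly_eqI) (simp add: dcoeff_dmonom_mult Abs_dirichlet_poly_inverse[OF b_in])
  then show "dmonom 1 c dvd f" by simp
qed

lemma dmonom_1_dvd_dmonom_1_iff:
  "dmonom 1 a dvd dmonom 1 b \<longleftrightarrow> a dvd (b :: 'a :: comm_ring_1)"
  by (subst dmonom_1_dvd_iff) (auto simp: dcoeff_dmonom)

lemma dmonom_1_dvd_1_iff: "dmonom 1 a dvd 1 \<longleftrightarrow> a dvd (1 :: 'a :: comm_ring_1)"
  using dmonom_1_dvd_dmonom_1_iff[of a 1] by (simp only: dmonom_1_1)

section \<open>Factorization into irreducible elements\<close>

text \<open>A measure that every proper factor lowers. The degree alone does not notice a constant
  nonunit being split off, so the prime factors of the leading coefficient are counted too.\<close>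

definition dsize :: "'a :: {idom, factorial_semiring} dirichlet_poly \<Rightarrow> nat" where
  "dsize f = ddegree f + size (prime_factorization (dcoeff f (ddegree f)))"

text \<open>Degrees multiply, and the prime factors of leading coefficients add up. A factor g of
  degree above 1 raises the degree; one of degree 1 is a constant nonunit and brings in a new prime
  factor.\<close>

lemma dsize_mult_less:
  fixes f g :: "'a :: {idom, factorial_semiring} dirichlet_poly"
  assumes nz: "f \<noteq> 0" "g \<noteq> 0" and "\<not> g dvd 1"
  shows "dsize f < dsize (f * g)"
proof -
  let ?a = "dcoeff f (ddegree f)" and ?b = "dcoeff g (ddegree g)"
  have pos: "ddegree f > 0" "ddegree g > 0" using nz by (auto intro: ddegree_pos)
  have eq: "dsize (f * g) = ddegree f * ddegree g + size (prime_factorization ?a)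
      + size (prime_factorization ?b)"
    using nz by (simp add: dsize_def ddegree_mult dcoeff_mult_ddegree prime_factorization_mult
        dcoeff_ddegree)
  show ?thesis
  proof (cases "ddegree g = 1")
    case True
    then have "\<not> ?b dvd 1"
      using assms(3) ddegree_eq_1D[OF True] dmonom_1_dvd_1_iff by metis
    then have "size (prime_factorization ?b) > 0"
      using nz by (simp add: prime_factorization_empty_iff dcoeff_ddegree nonempty_has_size[symmetric])
    with eq True show ?thesis by (simp add: dsize_def)
  next
    case False
    with pos have "ddegree f < ddegree f * ddegree g" by simp
    with eq show ?thesis by (simp only: dsize_def)
  qed
qed

text \<open>Induction on \<open>dsize\<close>: if f is neither a unit nor irreducible, it splits
  into two nonunits, both of smaller size.\<close>

lemma irreducible_factorization_exists:
  fixes f :: "'a :: {idom, factorial_semiring} dirichlet_poly"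
  assumes "f \<noteq> 0"
  shows "\<exists>A u. (\<forall>q\<in>#A. irreducible q) \<and> u dvd 1 \<and> f = u * prod_mset A"
  using assms
proof (induction "dsize f" arbitrary: f rule: less_induct)
  case less
  consider "f dvd 1" | "irreducible f" | a b where "f = a * b" "\<not> a dvd 1" "\<not> b dvd 1"
    using less.prems by (auto simp: irreducible_def)
  then show ?case
  proof cases
    case 1
    then show ?thesis by (intro exI[of _ "{#}"] exI[of _ f]) auto
  next
    case 2
    then show ?thesis by (intro exI[of _ "{#f#}"] exI[of _ 1]) auto
  next
    case 3
    then have nz: "a \<noteq> 0" "b \<noteq> 0" using less.prems by auto
    have "dsize a < dsize f" "dsize b < dsize f"
      using dsize_mult_less[of a b] dsize_mult_less[of b a] nz 3 by (auto simp: mult.commute)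
    then obtain A u where A: "\<forall>q\<in>#A. irreducible q" "u dvd 1" "a = u * prod_mset A"
      using less.hyps[of a] nz by blast
    obtain B v where B: "\<forall>q\<in>#B. irreducible q" "v dvd 1" "b = v * prod_mset B"
      using less.hyps[of b] \<open>dsize b < dsize f\<close> nz by blast
    show ?thesis
      using 3 A B mult_dvd_mono[of u 1 v 1]
      by (intro exI[of _ "A + B"] exI[of _ "u * v"]) (auto simp: algebra_simps)
  qed
qed

section \<open>Gauss's lemma for a polynomial extension inside an atomic domain\<close>

text \<open>Here S is a set and not a type, because the coefficient ring grows during the later
  induction while the ambient domain stays the same.\<close>

definition polys_over :: "'a :: comm_ring_1 set \<Rightarrow> 'a poly set" where
  "polys_over S = {P. \<forall>i. coeff P i \<in> S}"

text \<open>
  Since \<open>S\<close> and \<open>S[x]\<close> are closed under divisors, being irreducible and dividing mean the same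
  in \<open>S\<close>, in \<open>S[x]\<close> and in the ambient domain.
\<close>

locale divisor_closed_extension =
  fixes S :: "'a :: idom set" and x :: 'a
  assumes S_0: "0 \<in> S" and S_1: "1 \<in> S"
    and S_add: "a \<in> S \<Longrightarrow> b \<in> S \<Longrightarrow> a + b \<in> S"
    and S_uminus: "a \<in> S \<Longrightarrow> - a \<in> S"
    and S_mult: "a \<in> S \<Longrightarrow> b \<in> S \<Longrightarrow> a * b \<in> S"
    and S_dvd: "a * b \<in> S \<Longrightarrow> a * b \<noteq> 0 \<Longrightarrow> a \<in> S"
    and T_dvd: "a * b \<in> (\<lambda>P. poly P x) ` polys_over S \<Longrightarrow> a * b \<noteq> 0 \<Longrightarrow>
                  a \<in> (\<lambda>P. poly P x) ` polys_over S"
    and transcendental: "P \<in> polys_over S \<Longrightarrow> poly P x = 0 \<Longrightarrow> P = 0"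
    and factorization: "a \<noteq> 0 \<Longrightarrow> \<exists>A u. (\<forall>q\<in>#A. irreducible q) \<and> u dvd 1 \<and> a = u * prod_mset A"
    and prime_on_S: "irreducible q \<Longrightarrow> a \<in> S \<Longrightarrow> b \<in> S \<Longrightarrow> q dvd a * b \<Longrightarrow> q dvd a \<or> q dvd b"
begin

text \<open>The subring S[x] of the ambient domain; by \<open>transcendental\<close> it is a copy of
  the polynomial ring over S.\<close>

definition T :: "'a set" where "T = (\<lambda>P. poly P x) ` polys_over S"

lemma T_dvd': "a dvd b \<Longrightarrow> b \<in> T \<Longrightarrow> b \<noteq> 0 \<Longrightarrow> a \<in> T"
  unfolding T_def using T_dvd by (metis dvdE)

lemma S_dvd': "a dvd b \<Longrightarrow> b \<in> S \<Longrightarrow> b \<noteq> 0 \<Longrightarrow> a \<in> S"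
  using S_dvd by (metis dvdE)

lemma S_sum: "(\<And>i. i \<in> A \<Longrightarrow> f i \<in> S) \<Longrightarrow> sum f A \<in> S"
  by (induction A rule: infinite_finite_induct) (auto simp: S_0 S_add)

lemma polys_over_add: "P \<in> polys_over S \<Longrightarrow> Q \<in> polys_over S \<Longrightarrow> P + Q \<in> polys_over S"
  by (auto simp: polys_over_def S_add)

lemma polys_over_diff: "P \<in> polys_over S \<Longrightarrow> Q \<in> polys_over S \<Longrightarrow> P - Q \<in> polys_over S"
  using S_add[OF _ S_uminus] by (auto simp: polys_over_def)

lemma polys_over_mult: "P \<in> polys_over S \<Longrightarrow> Q \<in> polys_over S \<Longrightarrow> P * Q \<in> polys_over S"
  by (auto simp: polys_over_def coeff_mult intro!: S_sum S_mult)

lemma polys_over_monom: "a \<in> S \<Longrightarrow> monom a n \<in> polys_over S"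
  by (auto simp: polys_over_def S_0)

lemma polys_over_smult: "a \<in> S \<Longrightarrow> P \<in> polys_over S \<Longrightarrow> smult a P \<in> polys_over S"
  by (auto simp: polys_over_def S_mult)

lemma poly_eq_iff_polys_over:
  assumes "P \<in> polys_over S" "Q \<in> polys_over S"
  shows "poly P x = poly Q x \<longleftrightarrow> P = Q"
  using transcendental[OF polys_over_diff[OF assms]] by auto

lemma const_dvd_poly: "(\<And>i. c dvd coeff P i) \<Longrightarrow> c dvd poly P x"
  by (auto simp: poly_altdef intro!: dvd_sum)

text \<open>The classical argument for Gauss's lemma. If q divides neither factor, take the least i
  and j whose coefficients q does not divide. In the coefficient of index i + j of the product every
  other summand is divisible by q, so q divides a product of two elements of S without dividing
  either, against \<open>prime_on_S\<close>.\<close>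

lemma const_prime_on_T:
  assumes q: "irreducible q" "q \<in> S" and T: "a \<in> T" "b \<in> T" and dvd: "q dvd a * b"
  shows "q dvd a \<or> q dvd b"
proof (cases "a * b = 0")
  case False
  obtain P Q where P: "P \<in> polys_over S" "a = poly P x" and Q: "Q \<in> polys_over S" "b = poly Q x"
    using T by (auto simp: T_def)
  obtain w where w: "a * b = q * w" using dvd by blast
  have "a * b \<in> T"
    using P Q polys_over_mult[of P Q] by (auto simp: T_def intro!: image_eqI[of _ _ "P * Q"])
  \<comment> \<open>The cofactor has to lie in S[x] as well, for only then can the equation be
    compared coefficient by coefficient.\<close>
  then have "w \<in> T" using T_dvd'[of w "a * b"] False w by auto
  then obtain W where W: "W \<in> polys_over S" "w = poly W x" by (auto simp: T_def)
  have PQ: "P * Q = smult q W"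
    using w P Q W q
    by (subst poly_eq_iff_polys_over[symmetric]) (auto simp: polys_over_mult polys_over_smult)
  show ?thesis
  proof (rule ccontr)
    assume "\<not> ?thesis"
    then obtain i0 j0 where "\<not> q dvd coeff P i0" "\<not> q dvd coeff Q j0"
      using const_dvd_poly P Q by metis
    then obtain i j where i: "\<not> q dvd coeff P i" "\<And>k. k < i \<Longrightarrow> q dvd coeff P k"
      and j: "\<not> q dvd coeff Q j" "\<And>k. k < j \<Longrightarrow> q dvd coeff Q k"
      using exists_least_iff[of "\<lambda>i. \<not> q dvd coeff P i"]
        exists_least_iff[of "\<lambda>j. \<not> q dvd coeff Q j"] by blast
    have "coeff (P * Q) (i + j) = (\<Sum>k\<le>i + j. coeff P k * coeff Q (i + j - k))"
      by (simp add: coeff_mult)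
    also have "\<dots> = coeff P i * coeff Q j + (\<Sum>k\<in>{..i + j} - {i}. coeff P k * coeff Q (i + j - k))"
      by (subst sum.remove[of _ i]) auto
    finally have eq: "coeff (P * Q) (i + j) = \<dots>" .
    have "q dvd (\<Sum>k\<in>{..i + j} - {i}. coeff P k * coeff Q (i + j - k))"
    proof (rule dvd_sum)
      fix k assume "k \<in> {..i + j} - {i}"
      then consider "k < i" | "i + j - k < j" by force
      then show "q dvd coeff P k * coeff Q (i + j - k)"
        using i(2)[of k] j(2)[of "i + j - k"] by cases auto
    qed
    moreover have "q dvd coeff (P * Q) (i + j)" by (simp add: PQ)
    ultimately have "q dvd coeff P i * coeff Q j"
      unfolding eq by (simp add: dvd_add_left_iff)
    then show False
      using prime_on_S[OF q(1), of "coeff P i" "coeff Q j"] P Q i j by (auto simp: polys_over_def)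
  qed
qed auto

text \<open>Elements of S are primal in S[x]. The irreducible factors of c lie in S by divisor
  closure, so \<open>const_prime_on_T\<close> moves each of them into d or into e; induction deals
  with them one at a time.\<close>

lemma S_primal:
  assumes "c \<in> S" "c \<noteq> 0" "a \<noteq> 0" "c * a = d * e" "d \<in> T" "e \<in> T"
  shows "\<exists>c1 c2 d' e'. c = c1 * c2 \<and> d = c1 * d' \<and> e = c2 * e' \<and> a = d' * e'"
proof -
  obtain A u where A: "\<forall>q\<in>#A. irreducible q" "u dvd 1" "c = u * prod_mset A"
    using factorization[OF assms(2)] by blast
  show ?thesis using A assms
  proof (induction A arbitrary: c d e)
    case empty
    then obtain v where v: "u * v = 1" by (auto elim!: dvdE)
    \<comment> \<open>A unit c = u is assigned entirely to e, whose cofactor is then v * e.\<close>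
    have "e = u * (v * e)" "a = d * (v * e)"
      using empty v by (simp_all add: algebra_simps) (metis mult.assoc mult.commute mult_1)+
    then show ?case using empty by (intro exI[of _ 1] exI[of _ u] exI[of _ d] exI[of _ "v * e"]) simp
  next
    case (add q A)
    define c0 where "c0 = u * prod_mset A"
    have c: "c = q * c0" using add.prems by (simp add: c0_def algebra_simps)
    have q: "irreducible q" "q \<in> S" "q \<noteq> 0" and c0: "c0 \<in> S" "c0 \<noteq> 0"
      using add.prems c S_dvd'[of q c] S_dvd'[of c0 c] by auto
    have de: "d \<noteq> 0" "e \<noteq> 0" using add.prems by auto
    have "q dvd d * e" unfolding add.prems(7)[symmetric] c by (simp add: mult.assoc)
    then consider "q dvd d" | "q dvd e" using const_prime_on_T q add.prems by blast
    then show ?case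
    proof cases
      case 1
      then obtain d0 where d0: "d = q * d0" by blast
      have "c0 * a = d0 * e" using add.prems(7) c d0 q by (simp add: mult.assoc)
      moreover have "d0 \<in> T" using T_dvd'[of d0 d] d0 de add.prems by auto
      ultimately obtain c1 c2 d' e' where "c0 = c1 * c2" "d0 = c1 * d'" "e = c2 * e'" "a = d' * e'"
        using add.IH[OF _ _ c0_def c0 \<open>a \<noteq> 0\<close>, of d0 e] add.prems by auto
      then show ?thesis using c d0
        by (intro exI[of _ "q * c1"] exI[of _ c2] exI[of _ d'] exI[of _ e']) (simp add: mult.assoc)
    next
      case 2
      then obtain e0 where e0: "e = q * e0" by blast
      have "c0 * a = d * e0" using add.prems(7) c e0 q by (simp add: mult.assoc mult.left_commute)
      moreover have "e0 \<in> T" using T_dvd'[of e0 e] e0 de add.prems by auto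
      ultimately obtain c1 c2 d' e' where "c0 = c1 * c2" "d = c1 * d'" "e0 = c2 * e'" "a = d' * e'"
        using add.IH[OF _ _ c0_def c0 \<open>a \<noteq> 0\<close>, of d e0] add.prems by auto
      then show ?thesis using c e0
        by (intro exI[of _ c1] exI[of _ "q * c2"] exI[of _ d'] exI[of _ e']) (simp add: algebra_simps)
    qed
  qed
qed

lemma S_subset_T: "c \<in> S \<Longrightarrow> c \<in> T"
  unfolding T_def by (rule image_eqI[of _ _ "monom c 0"]) (auto simp: polys_over_monom poly_monom)

lemma T_mult: "a \<in> T \<Longrightarrow> b \<in> T \<Longrightarrow> a * b \<in> T"
  unfolding T_def by (auto simp flip: poly_mult intro!: imageI polys_over_mult)

text \<open>This takes the place of passing to the fraction field of S. Primality of c splits q as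
  c1 * q' with q' dividing a; since q is irreducible and not in S, the part c1 must be a
  unit.\<close>

lemma dvd_cancel_S:
  assumes q: "irreducible q" "q \<notin> S" and "c \<in> S" "c \<noteq> 0" "a \<in> T" "q dvd c * a"
  shows "q dvd a"
proof (cases "a = 0")
  case False
  obtain y where y: "c * a = q * y" using assms by blast
  have "c * a \<in> T" "c * a \<noteq> 0" using assms False T_mult S_subset_T by auto
  then have "q \<in> T" "y \<in> T" using T_dvd'[of _ "c * a"] y by auto
  then obtain c1 c2 q' y' where *: "c = c1 * c2" "q = c1 * q'" "y = c2 * y'" "a = q' * y'"
    using S_primal[OF \<open>c \<in> S\<close> \<open>c \<noteq> 0\<close> False y] by blast
  have c1: "c1 \<in> S" using S_dvd'[of c1 c] * assms by auto
  \<comment> \<open>Units divide 1 and hence lie in S, so a unit q' would put q = c1 * q' into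
    S.\<close>
  have "\<not> q' dvd 1"
    using q S_mult[OF c1, of q'] S_dvd'[of q' 1] S_1 * by auto
  then have "c1 dvd 1" using q * irreducible_def by blast
  then have "q dvd q'" using * mult_dvd_mono[of c1 1 q' q'] by simp
  then show ?thesis using * by simp
qed simp

text \<open>Pseudo-division by D: F is multiplied by the leading coefficient of D, as that
  coefficient need not be invertible. Remainders stay in I, so by minimality the division continues
  until the remainder is 0, and c collects the multipliers.\<close>

lemma min_degree_ideal_element_dvd:
  assumes I_sub: "I \<subseteq> polys_over S"
    and I_diff: "\<And>F G. F \<in> I \<Longrightarrow> G \<in> I \<Longrightarrow> F - G \<in> I"
    and I_mult: "\<And>F G. F \<in> polys_over S \<Longrightarrow> G \<in> I \<Longrightarrow> F * G \<in> I"
    and D: "D \<in> I" "D \<noteq> 0" "\<And>F. F \<in> I \<Longrightarrow> F \<noteq> 0 \<Longrightarrow> degree D \<le> degree F"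
    and F: "F \<in> I"
  shows "\<exists>c\<in>S - {0}. poly D x dvd c * poly F x"
  using F
proof (induction "degree F" arbitrary: F rule: less_induct)
  case less
  \<comment> \<open>One division step: the two terms of degree \<open>degree F\<close>
    cancel.\<close>
  define G where "G = monom (lead_coeff D) 0 * F - monom (lead_coeff F) (degree F - degree D) * D"
  have lc: "lead_coeff D \<in> S" "lead_coeff F \<in> S"
    using I_sub D less.prems by (auto simp: polys_over_def)
  show ?case
  proof (cases "F = 0")
    case True
    then show ?thesis using S_1 by (intro bexI[of _ 1]) auto
  next
    case False
    have deg: "degree D \<le> degree F" using D less.prems False by auto
    have G_I: "G \<in> I" unfolding G_def
      using lc D less.prems by (intro I_diff I_mult polys_over_monom)
    have "G = 0 \<or> degree G < degree F"
    proof -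
      have "coeff G (degree F) = lead_coeff D * lead_coeff F - lead_coeff F * lead_coeff D"
        using deg by (simp add: G_def coeff_monom_mult monom_0)
      then have "coeff G (degree F) = 0" by simp
      moreover have "degree G \<le> degree F"
        unfolding G_def using deg D(2) False
        by (intro degree_diff_le)
           (auto simp: monom_0 intro!: order.trans[OF degree_mult_le] order.trans[OF add_mono[OF degree_monom_le order.refl]])
      ultimately show ?thesis
        by (metis le_neq_implies_less leading_coeff_0_iff)
    qed
    then obtain c where c: "c \<in> S - {0}" "poly D x dvd c * poly G x"
      using less.hyps[OF _ G_I] S_1 by (cases "G = 0") (auto intro: that[of 1])
    have "poly G x = lead_coeff D * poly F x
        - lead_coeff F * x ^ (degree F - degree D) * poly D x"
      by (simp add: G_def poly_monom)
    then have "c * lead_coeff D * poly F x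
        = c * (poly G x + lead_coeff F * x ^ (degree F - degree D) * poly D x)"
      by simp
    also have "\<dots> = c * poly G x + c * lead_coeff F * x ^ (degree F - degree D) * poly D x"
      by (simp only: distrib_left mult.assoc)
    finally have "c * lead_coeff D * poly F x
        = c * poly G x + c * lead_coeff F * x ^ (degree F - degree D) * poly D x" .
    then have "poly D x dvd c * lead_coeff D * poly F x" using c by simp
    moreover have "c * lead_coeff D \<in> S - {0}" using c lc D S_mult by auto
    ultimately show ?thesis by blast
  qed
qed

text \<open>
  A nonzero element of least degree in the ideal of \<open>S[x]\<close> generated by \<open>q\<close> and \<open>a\<close> divides
  multiples of \<open>q\<close> and of \<open>a\<close> by constants from \<open>S\<close>.
  Either it is associated to \<open>q\<close> up to a constant, and then \<open>q\<close> divides \<open>a\<close>, or it is itself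
  a constant, and a Bezout argument gives that \<open>q\<close> divides \<open>b\<close>.
\<close>

lemma prime_on_T:
  assumes q: "irreducible q" and T: "a \<in> T" "b \<in> T" and dvd: "q dvd a * b"
  shows "q dvd a \<or> q dvd b"
proof (cases "a * b = 0 \<or> q \<in> S")
  case True
  then show ?thesis using assms const_prime_on_T by auto
next
  case False
  then have qS: "q \<notin> S" and nz: "a \<noteq> 0" "b \<noteq> 0" by auto
  have qT: "q \<in> T" using T_dvd'[OF dvd T_mult[OF T]] nz by simp
  have q0: "q \<noteq> 0" using q by auto
  obtain P Q where P: "P \<in> polys_over S" "a = poly P x" and Q: "Q \<in> polys_over S" "q = poly Q x"
    using T qT by (auto simp: T_def)
  define I where "I = {U * Q + V * P | U V. U \<in> polys_over S \<and> V \<in> polys_over S}"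
  have zero: "0 \<in> polys_over S" and one: "1 \<in> polys_over S"
    using polys_over_monom[OF S_0, of 0] polys_over_monom[OF S_1, of 0] by (auto simp: monom_0 one_pCons)
  have Q_I: "Q \<in> I" unfolding I_def using zero one by (intro CollectI exI[of _ 1] exI[of _ 0]) simp
  have P_I: "P \<in> I" unfolding I_def using zero one by (intro CollectI exI[of _ 0] exI[of _ 1]) simp
  have I_sub: "I \<subseteq> polys_over S"
    using P Q by (auto simp: I_def intro!: polys_over_add polys_over_mult)
  have I_diff: "F - G \<in> I" if FG: "F \<in> I" "G \<in> I" for F G
  proof -
    obtain U V U' V' where "F = U * Q + V * P" "G = U' * Q + V' * P"
      and m: "U \<in> polys_over S" "V \<in> polys_over S" "U' \<in> polys_over S" "V' \<in> polys_over S"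
      using FG by (auto simp: I_def)
    then have "F - G = (U - U') * Q + (V - V') * P" by (simp add: algebra_simps)
    then show ?thesis unfolding I_def using m polys_over_diff by blast
  qed
  have I_mult: "F * G \<in> I" if FG: "F \<in> polys_over S" "G \<in> I" for F G
  proof -
    obtain U V where "G = U * Q + V * P" and m: "U \<in> polys_over S" "V \<in> polys_over S"
      using FG by (auto simp: I_def)
    then have "F * G = (F * U) * Q + (F * V) * P" by (simp add: algebra_simps)
    then show ?thesis unfolding I_def using m FG polys_over_mult by blast
  qed
  have "Q \<noteq> 0" using Q q0 by auto
  with Q_I obtain D where D: "D \<in> I" "D \<noteq> 0" "\<And>F. F \<in> I \<Longrightarrow> F \<noteq> 0 \<Longrightarrow> degree D \<le> degree F"
    using ex_has_least_nat[of "\<lambda>F. F \<in> I \<and> F \<noteq> 0" Q degree] by auto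
  define d where "d = poly D x"
  have D_S: "D \<in> polys_over S" using D I_sub by auto
  then have d0: "d \<noteq> 0" and dT: "d \<in> T" using D transcendental by (auto simp: d_def T_def)
  have min_dvd: "\<exists>c\<in>S - {0}. d dvd c * poly F x" if "F \<in> I" for F
    unfolding d_def using min_degree_ideal_element_dvd[of I D F] I_sub I_diff I_mult D that by blast
  obtain c where c: "c \<in> S" "c \<noteq> 0" "d dvd c * q"
    using min_dvd[OF Q_I] Q by (auto simp: d_def)
  obtain c' where c': "c' \<in> S" "c' \<noteq> 0" "d dvd c' * a"
    using min_dvd[OF P_I] P by (auto simp: d_def)
  obtain e where e: "c * q = d * e" using c by blast
  have "c * q \<in> T" "c * q \<noteq> 0" using c qT q0 T_mult S_subset_T by auto
  then have "e \<in> T" using T_dvd'[of e "c * q"] e by auto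
  \<comment> \<open>The constant c is distributed over d * e, which leaves a factorization of q
    itself; its irreducibility gives the two cases.\<close>
  then obtain c1 c2 d' e' where *: "c = c1 * c2" "d = c1 * d'" "e = c2 * e'" "q = d' * e'"
    using S_primal[OF c(1,2) q0 e dT] by blast
  have c1: "c1 \<in> S" using S_dvd'[of c1 c] * c by auto
  consider "d' dvd 1" | "e' dvd 1" using q * unfolding irreducible_def by blast
  then show ?thesis
  proof cases
    case 1
    \<comment> \<open>Units lie in S, so d = c1 * d' does too and can be cancelled from
      \<open>q dvd d * b\<close>.\<close>
    then have "d \<in> S" using * S_mult[OF c1] S_dvd'[of d' 1] S_1 by auto
    moreover obtain U V where "D = U * Q + V * P" using D by (auto simp: I_def)
    then have "d * b = poly U x * q * b + poly V x * (a * b)"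
      using P Q by (simp add: d_def algebra_simps)
    then have "q dvd d * b" using dvd by simp
    ultimately show ?thesis using dvd_cancel_S[OF q qS _ d0 T(2)] by blast
  next
    case 2
    \<comment> \<open>Now q is associated to d', a divisor of d, and d divides c' * a with c' in
      S.\<close>
    then have "q dvd d'" using * mult_dvd_mono[of d' d' e' 1] by simp
    then have "q dvd c' * a" using * c' by (meson dvd_mult dvd_trans)
    then show ?thesis using dvd_cancel_S[OF q qS c'(1,2) T(1)] by blast
  qed
qed

end

section \<open>Irreducible Dirichlet polynomials are prime\<close>

lemma dirichlet_poly_exists:
  assumes "a 0 = 0" "finite {i. a i \<noteq> 0}"
  obtains f where "\<And>i. dcoeff f i = a i"
  using assms that[of "Abs_dirichlet_poly a"] by (simp add: Abs_dirichlet_poly_inverse)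

text \<open>Order the indices by the multiplicity of p and then by size. The top terms of f and g in
  this order multiply without cancellation, and the top index of f is divisible by p because some
  index of f is.\<close>

lemma dcoeff_mult_prime_dvd:
  fixes f g :: "'a :: idom dirichlet_poly"
  assumes p: "prime p" and i: "dcoeff f i \<noteq> 0" "p dvd i" and "g \<noteq> 0"
  obtains l where "dcoeff (f * g) l \<noteq> 0" "p dvd l"
proof -
  have max: "\<exists>i M. dcoeff h i \<noteq> 0 \<and> multiplicity p i = M \<and>
      (\<forall>j. dcoeff h j \<noteq> 0 \<longrightarrow> multiplicity p j \<le> M \<and> (multiplicity p j = M \<longrightarrow> j \<le> i))"
    if "h \<noteq> 0" for h :: "'a dirichlet_poly"
  proof -
    define M where "M = Max (multiplicity p ` {i. dcoeff h i \<noteq> 0})"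
    have ne: "{i. dcoeff h i \<noteq> 0} \<noteq> {}" using that dcoeff_ddegree by blast
    then have "M \<in> multiplicity p ` {i. dcoeff h i \<noteq> 0}" unfolding M_def by (intro Max_in) auto
    then have ne': "{i. dcoeff h i \<noteq> 0 \<and> multiplicity p i = M} \<noteq> {}" by auto
    have fin: "finite {i. dcoeff h i \<noteq> 0 \<and> multiplicity p i = M}"
      by (rule finite_subset[OF _ finite_dcoeff[of h]]) auto
    from Max_in[OF fin ne'] Max_ge[OF fin] show ?thesis
      by (intro exI[of _ "Max {i. dcoeff h i \<noteq> 0 \<and> multiplicity p i = M}"] exI[of _ M])
         (auto simp: M_def)
  qed
  have "f \<noteq> 0" using i by auto
  then obtain i0 M where i0: "dcoeff f i0 \<noteq> 0" "multiplicity p i0 = M"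
    "\<And>j. dcoeff f j \<noteq> 0 \<Longrightarrow> multiplicity p j \<le> M"
    "\<And>j. dcoeff f j \<noteq> 0 \<Longrightarrow> multiplicity p j = M \<Longrightarrow> j \<le> i0"
    using max by metis
  obtain j0 N where j0: "dcoeff g j0 \<noteq> 0" "multiplicity p j0 = N"
    "\<And>j. dcoeff g j \<noteq> 0 \<Longrightarrow> multiplicity p j \<le> N"
    "\<And>j. dcoeff g j \<noteq> 0 \<Longrightarrow> multiplicity p j = N \<Longrightarrow> j \<le> j0"
    using max[OF \<open>g \<noteq> 0\<close>] by metis
  have nz: "j \<noteq> 0" if "dcoeff h j \<noteq> 0" for h :: "'a dirichlet_poly" and j
    using that by (metis dcoeff_0_right)
  have "dcoeff (f * g) (i0 * j0) = dcoeff f i0 * dcoeff g j0"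
  proof (rule dcoeff_mult_unique)
    fix i' j' assume *: "dcoeff f i' \<noteq> 0" "dcoeff g j' \<noteq> 0" and eq: "i' * j' = i0 * j0"
    have pos: "i' > 0" "j' > 0" "i0 > 0" "j0 > 0" using nz * i0(1) j0(1) by auto
    have "multiplicity p (i' * j') = multiplicity p i' + multiplicity p j'"
      "multiplicity p (i0 * j0) = M + N"
      using p pos i0(2) j0(2) by (auto simp: prime_elem_multiplicity_mult_distrib)
    then have "multiplicity p i' = M" "multiplicity p j' = N"
      using eq i0(3)[OF *(1)] j0(3)[OF *(2)] by auto
    then have le: "i' \<le> i0" "j' \<le> j0" using i0(4) j0(4) * by auto
    then show "i' = i0 \<and> j' = j0" using mult_eq_mult_le_imp_eq eq pos by simp
  qed (use nz i0(1) j0(1) in auto)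
  then have "dcoeff (f * g) (i0 * j0) \<noteq> 0" using i0(1) j0(1) by simp
  moreover have "multiplicity p i > 0"
    using p i nz[OF i(1)] by (simp add: prime_multiplicity_gt_zero_iff)
  then have "p dvd i0" using i0(2) i0(3)[OF i(1)] not_dvd_imp_multiplicity_0[of p i0] by force
  ultimately show ?thesis using that by simp
qed

text \<open>The bound is strict, so \<open>dsmooth 0\<close> consists of the constants, and passing
  from k to \<open>Suc k\<close> adjoins k if k is prime and changes nothing otherwise.\<close>

definition dsmooth :: "nat \<Rightarrow> 'a :: zero dirichlet_poly set" where
  "dsmooth k = {f. \<forall>i p. dcoeff f i \<noteq> 0 \<longrightarrow> prime p \<longrightarrow> p dvd i \<longrightarrow> p < k}"

lemma dsmooth_mono: "k \<le> l \<Longrightarrow> f \<in> dsmooth k \<Longrightarrow> f \<in> dsmooth l"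
  unfolding dsmooth_def using less_le_trans by blast

lemma dsmooth_ddegree: "(f :: 'a :: comm_ring_1 dirichlet_poly) \<in> dsmooth (Suc (ddegree f))"
proof -
  have "p \<le> ddegree f" if "dcoeff f i \<noteq> 0" "p dvd i" for i p
    using that ddegree_ge[of f i] dvd_imp_le[of p i] by (cases "i = 0") auto
  then show ?thesis by (auto simp: dsmooth_def less_Suc_eq_le)
qed

lemma dsmooth_add:
  "f \<in> dsmooth k \<Longrightarrow> g \<in> dsmooth k \<Longrightarrow> f + g \<in> dsmooth k"
  for f g :: "'a :: comm_ring_1 dirichlet_poly"
  unfolding dsmooth_def by auto (metis add.right_neutral)

lemma dsmooth_mult:
  fixes f g :: "'a :: comm_ring_1 dirichlet_poly"
  assumes "f \<in> dsmooth k" "g \<in> dsmooth k"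
  shows "f * g \<in> dsmooth k"
  unfolding dsmooth_def
proof (safe)
  fix i p :: nat assume nz: "dcoeff (f * g) i \<noteq> 0" and p: "prime p" "p dvd i"
  from nz obtain j l where "i = j * l" "dcoeff f j \<noteq> 0" "dcoeff g l \<noteq> 0"
    by (rule dcoeff_mult_nonzeroE)
  then show "p < k" using p assms by (auto simp: dsmooth_def prime_dvd_mult_iff)
qed

text \<open>A prime occurring in an index of f still occurs in some index of f * g by
  \<open>dcoeff_mult_prime_dvd\<close>. This supplies the divisor closure required of S and of
  S[x].\<close>

lemma dsmooth_dvd:
  fixes f g :: "'a :: idom dirichlet_poly"
  assumes "f * g \<in> dsmooth k" "f * g \<noteq> 0"
  shows "f \<in> dsmooth k"
  unfolding dsmooth_def
proof (safe)
  fix i p :: nat assume nz: "dcoeff f i \<noteq> 0" and p: "prime p" "p dvd i"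
  have "g \<noteq> 0" using assms by auto
  then obtain l where "dcoeff (f * g) l \<noteq> 0" "p dvd l"
    using dcoeff_mult_prime_dvd p nz by metis
  then show "p < k" using assms p by (auto simp: dsmooth_def)
qed

lemma dsmooth_Suc_not_prime: "\<not> prime k \<Longrightarrow> dsmooth (Suc k) = dsmooth k"
  unfolding dsmooth_def less_Suc_eq by blast

lemma dsmooth_not_dvd:
  assumes "prime p" "f \<in> dsmooth p" "p dvd i"
  shows "dcoeff f i = 0"
  using assms by (auto simp: dsmooth_def)

lemma dsmooth_0D:
  assumes "(f :: 'a :: comm_ring_1 dirichlet_poly) \<in> dsmooth 0"
  shows "f = dmonom 1 (dcoeff f 1)"
proof (rule dirichlet_poly_eqI)
  fix i
  show "dcoeff f i = dcoeff (dmonom 1 (dcoeff f 1)) i"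
    using assms prime_factor_nat[of i] by (auto simp: dsmooth_def dcoeff_dmonom)
qed

text \<open>This identifies S[x] for x = p^(-s). Conversely to evaluation, write f = f0 + x * f1,
  where f0 collects the indices prime to p, and repeat with f1, whose degree is smaller.\<close>

lemma poly_dsmooth_Suc_iff:
  fixes f :: "'a :: comm_ring_1 dirichlet_poly"
  assumes p: "prime p"
  shows "f \<in> (\<lambda>P. poly P (dmonom p 1)) ` polys_over (dsmooth p) \<longleftrightarrow> f \<in> dsmooth (Suc p)"
proof
  have "poly P (dmonom p 1) \<in> dsmooth (Suc p)" if "P \<in> polys_over (dsmooth p)"
    for P :: "'a dirichlet_poly poly"
    using that
  proof (induction P)
    case 0
    then show ?case by (simp add: dsmooth_def)
  next
    case (pCons a P)
    have "a \<in> dsmooth p" "P \<in> polys_over (dsmooth p)"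
      using pCons.prems by (auto simp: polys_over_def coeff_pCons split: nat.splits)
    moreover have "dmonom p 1 \<in> (dsmooth (Suc p) :: 'a dirichlet_poly set)"
      using p by (auto simp: dsmooth_def dcoeff_dmonom less_Suc_eq_le dvd_imp_le split: if_splits)
    ultimately show ?case
      using pCons.IH by (auto intro!: dsmooth_add dsmooth_mult intro: dsmooth_mono[of p "Suc p"])
  qed
  then show "f \<in> dsmooth (Suc p)" if "f \<in> (\<lambda>P. poly P (dmonom p 1)) ` polys_over (dsmooth p)"
    using that by auto
next
  have p0: "p > 1" using p prime_gt_1_nat by blast
  show "f \<in> (\<lambda>P. poly P (dmonom p 1)) ` polys_over (dsmooth p)" if "f \<in> dsmooth (Suc p)"
    using that
  proof (induction "ddegree f" arbitrary: f rule: less_induct)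
    case less
    show ?case
    proof (cases "f = 0")
      case True
      then show ?thesis by (intro image_eqI[of _ _ 0]) (auto simp: polys_over_def dsmooth_def)
    next
      case False
      have fin1: "finite {i. (if p dvd i then 0 else dcoeff f i) \<noteq> 0}"
        by (rule finite_subset[OF _ finite_dcoeff[of f]]) auto
      have fin2: "finite {i. dcoeff f (p * i) \<noteq> 0}"
        using finite_vimageI[OF finite_dcoeff[of f], of "\<lambda>i. p * i"] p0 by (simp add: inj_on_def)
      obtain f0 where f0: "\<And>i. dcoeff f0 i = (if p dvd i then 0 else dcoeff f i)"
        using dirichlet_poly_exists[OF _ fin1] by auto
      obtain f1 where f1: "\<And>i. dcoeff f1 i = dcoeff f (p * i)"
        using dirichlet_poly_exists[OF _ fin2] by auto
      have eq: "f = f0 + dmonom p 1 * f1"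
        using p0 by (intro dirichlet_poly_eqI) (auto simp: f0 f1 dcoeff_dmonom_mult)
      have "f0 \<in> dsmooth p"
        using less.prems by (auto simp: dsmooth_def f0 less_Suc_eq split: if_splits)
      moreover have "f1 \<in> dsmooth (Suc p)"
        using less.prems by (auto simp: dsmooth_def f1)
      moreover have "ddegree f1 < ddegree f"
      proof (cases "f1 = 0")
        case True
        \<comment> \<open>The zero polynomial has degree 0 by convention, below the positive degree
          of f.\<close>
        then show ?thesis using ddegree_pos[OF False] by (simp add: ddegree_def)
      next
        case False
        then have "p * ddegree f1 \<le> ddegree f"
          using dcoeff_ddegree[of f1] f1 by (intro ddegree_ge) auto
        moreover have "ddegree f1 < p * ddegree f1" using ddegree_pos[OF False] p0 by simp
        ultimately show ?thesis by linarith
      qed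
      ultimately obtain P where "P \<in> polys_over (dsmooth p)" "f1 = poly P (dmonom p 1)"
        using less.hyps by auto
      with \<open>f0 \<in> dsmooth p\<close> eq show ?thesis
        by (intro image_eqI[of _ _ "pCons f0 P"])
           (auto simp: polys_over_def coeff_pCons split: nat.split)
    qed
  qed
qed

text \<open>The constant coefficient is supported away from the multiples of p and the rest, a
  multiple of x, is supported on them. Hence both vanish, and after cancelling x the argument
  repeats.\<close>

lemma poly_dmonom_eq_0D:
  fixes P :: "'a :: comm_ring_1 dirichlet_poly poly"
  assumes p: "prime p" and "P \<in> polys_over (dsmooth p)" "poly P (dmonom p 1) = 0"
  shows "P = 0"
  using assms(2,3)
proof (induction P)
  case (pCons a P)
  have p0: "p > 0" using p prime_gt_0_nat by blast
  have a: "a \<in> dsmooth p" and P: "P \<in> polys_over (dsmooth p)"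
    using pCons.prems(1) by (auto simp: polys_over_def coeff_pCons split: nat.splits)
  have eq: "dcoeff a i + dcoeff (dmonom p 1 * poly P (dmonom p 1)) i = 0" for i
    using pCons.prems(2) by (metis dcoeff_0 dcoeff_add poly_pCons)
  have "dcoeff a i = 0" for i
    using eq[of i] dsmooth_not_dvd[OF p a, of i] p0 by (auto simp: dcoeff_dmonom_mult split: if_splits)
  then have "a = 0" by (intro dirichlet_poly_eqI) simp
  moreover have "dcoeff (poly P (dmonom p 1)) i = 0" for i
    using eq[of "p * i"] dsmooth_not_dvd[OF p a, of "p * i"] p0 by (simp add: dcoeff_dmonom_mult)
  then have "poly P (dmonom p 1) = 0" by (intro dirichlet_poly_eqI) simp
  ultimately show ?case using pCons.IH P by simp
qed simp

text \<open>Induction over the stages: constants are handled by unique factorization in the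
  coefficient ring, and each new prime by \<open>prime_on_T\<close>.\<close>

lemma irreducible_dvd_mult_dsmooth:
  fixes q a b :: "'a :: {idom, factorial_semiring} dirichlet_poly"
  assumes q: "irreducible q" and "a \<in> dsmooth k" "b \<in> dsmooth k" "q dvd a * b"
  shows "q dvd a \<or> q dvd b"
  using assms
proof (induction k arbitrary: q a b)
  case 0
  define r s where "r = dcoeff a 1" and "s = dcoeff b 1"
  have ab: "a = dmonom 1 r" "b = dmonom 1 s"
    using dsmooth_0D 0 by (auto simp: r_def s_def)
  show ?case
  proof (cases "a * b = 0")
    case False
    \<comment> \<open>A divisor of a nonzero constant is constant, so q comes from an element c of
      the coefficient ring.\<close>
    then have "q \<in> dsmooth 0"
      using dsmooth_mult[OF 0(2,3)] 0(4) dsmooth_dvd by (metis dvdE)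
    then obtain c where c: "q = dmonom 1 c" using dsmooth_0D by blast
    have "irreducible c"
    proof (rule irreducibleI)
      show "c \<noteq> 0"
      proof
        assume "c = 0"
        then have "q = 0" using c by (intro dirichlet_poly_eqI) (simp add: dcoeff_dmonom)
        then show False using 0 by simp
      qed
      show "\<not> c dvd 1" using 0(1) c dmonom_1_dvd_1_iff irreducible_def by blast
      fix u v assume "c = u * v"
      then have "q = dmonom 1 u * dmonom 1 v" by (simp only: c dmonom_1_mult_dmonom_1)
      then show "u dvd 1 \<or> v dvd 1"
        using irreducibleD[OF 0(1)] dmonom_1_dvd_1_iff by blast
    qed
    then have "prime_elem c" by (rule irreducible_imp_prime_elem)
    moreover have "c dvd r * s"
      using 0(4) by (simp only: ab c dmonom_1_mult_dmonom_1 dmonom_1_dvd_dmonom_1_iff)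
    ultimately show ?thesis
      by (simp only: ab c dmonom_1_dvd_dmonom_1_iff prime_elem_dvd_mult_iff)
  qed auto
next
  case (Suc k)
  show ?case
  proof (cases "prime k")
    case False
    then show ?thesis using Suc by (simp add: dsmooth_Suc_not_prime)
  next
    case True
    \<comment> \<open>The induction hypothesis serves as \<open>prime_on_S\<close>; divisor closure
      of S[x] is that of the next stage.\<close>
    interpret divisor_closed_extension "dsmooth k :: 'a dirichlet_poly set" "dmonom k 1"
    proof
      show "f \<in> dsmooth k \<Longrightarrow> - f \<in> dsmooth k" for f :: "'a dirichlet_poly"
        by (simp add: dsmooth_def)
      show "0 \<in> (dsmooth k :: 'a dirichlet_poly set)" "1 \<in> (dsmooth k :: 'a dirichlet_poly set)"
        by (auto simp: dsmooth_def dcoeff_1)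
      show "f \<in> (\<lambda>P. poly P (dmonom k 1)) ` polys_over (dsmooth k)"
        if "f * g \<in> (\<lambda>P. poly P (dmonom k 1)) ` polys_over (dsmooth k)" "f * g \<noteq> 0"
        for f g :: "'a dirichlet_poly"
        using that unfolding poly_dsmooth_Suc_iff[OF True] by (rule dsmooth_dvd)
    qed (use Suc.IH True in \<open>blast intro: dsmooth_add dsmooth_mult dsmooth_dvd poly_dmonom_eq_0D
           irreducible_factorization_exists\<close>)+
    have "T = dsmooth (Suc k)"
      unfolding T_def using poly_dsmooth_Suc_iff[OF True] by blast
    then show ?thesis using prime_on_T Suc.prems by simp
  qed
qed

text \<open>Only finitely many primes occur in the indices of a and b, so both lie in a common
  stage, bounded by their degrees.\<close>

lemma irreducible_imp_prime_elem_dirichlet_poly: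
  fixes q :: "'a :: {idom, factorial_semiring} dirichlet_poly"
  assumes "irreducible q"
  shows "prime_elem q"
proof (rule prime_elemI)
  fix a b assume "q dvd a * b"
  then show "q dvd a \<or> q dvd b"
    using assms
    by (intro irreducible_dvd_mult_dsmooth[of q a "Suc (max (ddegree a) (ddegree b))" b]
          dsmooth_mono[OF _ dsmooth_ddegree]) auto
qed (use assms in \<open>auto simp: irreducible_def\<close>)

section \<open>Square-free Dirichlet polynomials\<close>

text \<open>Remove one irreducible factor, f = q * h, and write g = h * c by induction. The prime q
  divides g but not h, as f is square-free, so it divides c and q * h divides g.\<close>

lemma dsquare_free_dvd_power:
  fixes f g :: "'a :: {idom, factorial_semiring} dirichlet_poly"
  assumes "f \<noteq> 0" "dsquare_free f" "f dvd g ^ m"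
  shows "f dvd g"
proof -
  obtain A u where A: "\<forall>q\<in>#A. irreducible q" "u dvd 1" "f = u * prod_mset A"
    using irreducible_factorization_exists[OF assms(1)] by blast
  show ?thesis using A assms(2,3)
  proof (induction A arbitrary: f)
    case empty
    then have "f dvd 1" by simp
    then show ?case using one_dvd by (rule dvd_trans)
  next
    case (add q A)
    define h where "h = u * prod_mset A"
    have f: "f = q * h" using add.prems by (simp add: h_def algebra_simps)
    have q: "prime_elem q" "irreducible q"
      using add.prems by (auto intro: irreducible_imp_prime_elem_dirichlet_poly)
    have "dsquare_free h" using add.prems(4) f dvd_mult unfolding dsquare_free_def by blast
    moreover have "h dvd g ^ m" using add.prems(5) f dvd_mult_right by blast
    ultimately have "h dvd g" using add.IH[OF _ add.prems(2) h_def] add.prems(1) by simp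
    then obtain c where c: "g = h * c" by blast
    have "q dvd g ^ m" using add.prems(5) f dvd_mult_left by blast
    then have "q dvd g" using q(1) prime_elem_dvd_power by blast
    moreover have "\<not> q dvd h"
      using add.prems(4) q(2) mult_dvd_mono[OF dvd_refl[of q], of q h]
      unfolding dsquare_free_def f power2_eq_square by blast
    ultimately have "q dvd c" using q c by (simp add: prime_elem_dvd_mult_iff)
    then show ?case using f c by (simp add: mult.commute)
  qed
qed

text \<open>The case g = 0 is excluded because f divides 0, while \<open>ddegree\<close> gives the
  zero polynomial the placeholder value 0.\<close>

theorem theorem7p12:
  fixes f :: "'a :: {idom, factorial_semiring} dirichlet_poly" and n m :: nat
  assumes "dprimitive f"
    and "ddegree f = n"
    and "n \<ge> 2"
    and "\<not> squarefree n"
    and "m \<ge> 2"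
  shows "(dsquare_free f \<longleftrightarrow>
            (\<forall>p g. p \<in> prime_factors n \<and> multiplicity p n \<ge> 2 \<and>
                   g \<noteq> 0 \<and> ddegree g \<le> n div p \<longrightarrow> \<not> f dvd g ^ m)) \<and>
         (dsquare_free f \<longleftrightarrow>
            (\<forall>p g. p \<in> prime_factors n \<and> multiplicity p n \<ge> 2 \<and>
                   g \<noteq> 0 \<and> ddegree g = n div p \<longrightarrow> \<not> f dvd g ^ m))"
proof -
  have f0: "f \<noteq> 0" using assms(2,3) by (auto simp: ddegree_def)
  have i_ii: "\<not> f dvd g ^ m"
    if "dsquare_free f" and p: "p \<in> prime_factors n" and g: "g \<noteq> 0" "ddegree g \<le> n div p" for p g
  proof
    assume "f dvd g ^ m"
    then have "n dvd ddegree g"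
      using ddegree_dvd[OF dsquare_free_dvd_power[OF f0 that(1)] g(1)] assms(2) by simp
    then have "n \<le> n div p" using g(2) dvd_imp_le[OF _ ddegree_pos[OF g(1)]] by (meson order_trans)
    moreover have "p > 1" using p prime_gt_1_nat by (auto simp: in_prime_factors_iff)
    then have "n div p < n" using assms(3) by simp
    ultimately show False by simp
  qed
  have iii_i: "\<exists>p g. p \<in> prime_factors n \<and> multiplicity p n \<ge> 2 \<and>
                   g \<noteq> 0 \<and> ddegree g = n div p \<and> f dvd g ^ m" if nsf: "\<not> dsquare_free f"
  proof -
    obtain q h where q: "irreducible q" and f: "f = q\<^sup>2 * h"
      using nsf unfolding dsquare_free_def dvd_def by blast
    have nz: "q \<noteq> 0" "h \<noteq> 0" using f0 f by auto
    define d where "d = ddegree q"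
    have n: "n = d\<^sup>2 * ddegree h"
      using nz f assms(2) by (simp add: ddegree_mult d_def power2_eq_square)
    \<comment> \<open>A constant q would divide every coefficient of f and be a unit by
      primitivity.\<close>
    have "d \<noteq> 1"
    proof
      assume "d = 1"
      then obtain c where c: "q = dmonom 1 c" using ddegree_eq_1D[of q] by (auto simp: d_def)
      have "q dvd f" using f by (simp add: power2_eq_square)
      then have "c dvd 1" using assms(1) unfolding c dmonom_1_dvd_iff dprimitive_def by blast
      then have "q dvd 1" by (simp only: c dmonom_1_dvd_1_iff)
      then show False using irreducible_not_unit[OF q] by contradiction
    qed
    then obtain p where p: "prime p" and "p dvd d" using prime_factor_nat by blast
    then obtain e where e: "d = p * e" by blast
    have pos: "p > 0" "e > 0" using ddegree_pos[OF nz(1)] unfolding d_def[symmetric] e by simp_all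
    \<comment> \<open>With d = p * e, the quotient n / p is e * d * \<open>ddegree h\<close>. Since
      q * h has degree d * \<open>ddegree h\<close>, the monomial e^(-s) contributes exactly the
      missing factor e.\<close>
    define g where "g = dmonom e 1 * (q * h)"
    have "dcoeff (dmonom e 1) e \<noteq> dcoeff (0 :: 'a dirichlet_poly) e"
      using pos by (simp add: dcoeff_dmonom)
    then have e_nz: "dmonom e 1 \<noteq> (0 :: 'a dirichlet_poly)" by metis
    have "g \<noteq> 0" using nz e_nz by (simp add: g_def)
    moreover have "ddegree g = n div p"
      using nz e_nz pos by (simp add: g_def ddegree_mult ddegree_dmonom n e power2_eq_square flip: d_def)
    moreover have "p\<^sup>2 dvd n" by (simp add: n e power_mult_distrib)
    then have "multiplicity p n \<ge> 2"
      using p assms(3) by (intro multiplicity_geI) (auto simp: not_prime_unit)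
    moreover have "p \<in> prime_factors n"
      using p assms(3) \<open>p\<^sup>2 dvd n\<close> by (auto simp: in_prime_factors_iff power2_eq_square elim: dvd_mult_left)
    \<comment> \<open>The square of q * h equals f * h, and m \<ge> 2 carries this over to the m-th
      power.\<close>
    moreover have "f dvd (q * h)\<^sup>2" by (simp add: f power_mult_distrib power2_eq_square[of h])
    then have "f dvd (q * h) ^ m"
      using le_imp_power_dvd[OF assms(5), of "q * h"] by (rule dvd_trans)
    then have "f dvd g ^ m"
      unfolding g_def power_mult_distrib[of "dmonom e 1"] by (rule dvd_mult)
    ultimately show ?thesis by blast
  qed
  show ?thesis
  \<comment> \<open>The bound in \<open>i_ii\<close> covers both degree conditions, and the witness
    of \<open>iii_i\<close> has degree exactly n / p, so it refutes both.\<close>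
  proof (intro conjI iffI)
    assume "dsquare_free f"
    then show "\<forall>p g. p \<in> prime_factors n \<and> multiplicity p n \<ge> 2 \<and>
        g \<noteq> 0 \<and> ddegree g \<le> n div p \<longrightarrow> \<not> f dvd g ^ m"
      and "\<forall>p g. p \<in> prime_factors n \<and> multiplicity p n \<ge> 2 \<and>
        g \<noteq> 0 \<and> ddegree g = n div p \<longrightarrow> \<not> f dvd g ^ m"
      using i_ii by auto
  next
    assume "\<forall>p g. p \<in> prime_factors n \<and> multiplicity p n \<ge> 2 \<and>
        g \<noteq> 0 \<and> ddegree g \<le> n div p \<longrightarrow> \<not> f dvd g ^ m"
    then show "dsquare_free f" using iii_i order_refl by metis
  next
    assume "\<forall>p g. p \<in> prime_factors n \<and> multiplicity p n \<ge> 2 \<and>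
        g \<noteq> 0 \<and> ddegree g = n div p \<longrightarrow> \<not> f dvd g ^ m"
    then show "dsquare_free f" using iii_i by blast
  qed
qed

end
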